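(* Let $x_t\sim CSA(a,b)$, that is, let $x_t$ be the series generated by cross-sectional aggregation, $x_t=\frac{1}{\sqrt N}\sum_{i=1}^N x_{i,t}$, of autoregressive processes with random coefficients governed by the Beta distribution with parameters $a,b>0$, and let $h\in\mathbb{N}$. Assume a Type II process; in particular, assume $\nu_j=0$ for all $j<0$. Then the minimum mean square error forecast $h$ periods ahead, $\hat x_{T+h}$, can be computed as $$\hat x_{T+h}=\sum_{j=h}^{T}\phi_j\,\nu_{T-j+h},$$ where $\nu_i$ is computed as $$\nu_i=x_i-\sum_{j=1}^{i}\phi_j\nu_{i-j}\qquad\text{for all } i\in\{0,1,\dots,T\},$$ with $$\phi_j=\left(\frac{B(a+j,b)}{B(a,b)}\right)^{1/2}\quad\text{for all } j\in\mathbb{N},$$ where $B(\cdot,\cdot)$ is the Beta function.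
   Context: Definition of $CSA(a,b)$: $x_t=\frac{1}{\sqrt N}\sum_{i=1}^N x_{i,t}$, where the individual series are $x_{i,t}=\alpha_i x_{i,t-1}+\epsilon_{i,t}$ for $i=1,\dots,N$, the $\epsilon_{i,t}$ are i.i.d. with $E[\epsilon_{i,t}^2]=\sigma_\epsilon^2$, and $\alpha_i^2$ is sampled from the Beta distribution with parameters $a,b>0$, whose density is $\frac{1}{B(a,b)}u^{a-1}(1-u)^{b-1}$ for $u\in(0,1)$, where $B(\cdot,\cdot)$ is the Beta function. The process is considered in the limit as the cross-sectional dimension $N\to\infty$. The observed sample is $x_0,x_1,\dots,x_T$, the parameters $a,b$ are taken as known, and $\hat x_{T+h}$ is the forecast of $x_{T+h}$ based on this sample. The $\nu_j$ are the innovations of the moving-average representation of the process with coefficients $\phi_j$; "Type II" is meant analogously to samples of fractionally differenced processes, with innovations before time $0$ set to zero.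
   Formalization: The forecast sum runs to T+h, not T (the printed sum drops nonzero terms and is not optimal for h≥1); the limit in N is taken in distribution at each date, and x_t is assumed to have a moving-average form with i.i.d. centred ν_j, φ_0=1, φ_j≥0, since the joint limit contradicts it. *)

theory Defs
  imports "HOL-Probability.Probability"
begin

definition beta_density :: "real \<Rightarrow> real \<Rightarrow> real \<Rightarrow> real" where
  "beta_density a b u =
     (if 0 < u \<and> u < 1 then u powr (a - 1) * (1 - u) powr (b - 1) / Beta a b else 0)"

(* A Type II panel of AR(1) series with random coefficients: innovations dated before 0
   vanish and the series start from 0. Individuals are indexed from 0. Only the law of
   alpha_i^2 is specified; the sign of alpha_i is left free. The single indep_vars
   hypothesis on the disjoint sum of index sets says that all coefficients and all
   innovations are jointly independent. *)
locale csa_panel = prob_space P for P :: "'p measure" +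
  fixes a b \<sigma> :: real
    and \<alpha> :: "nat \<Rightarrow> 'p \<Rightarrow> real"
    and \<epsilon> :: "nat \<Rightarrow> int \<Rightarrow> 'p \<Rightarrow> real"
    and X :: "nat \<Rightarrow> int \<Rightarrow> 'p \<Rightarrow> real"
  assumes indep: "indep_vars (\<lambda>_. borel) (case_sum \<alpha> (\<lambda>(i, t). \<epsilon> i t)) (UNIV <+> UNIV \<times> {0..})"
    and coeff_ident: "distr P borel (\<alpha> i) = distr P borel (\<alpha> 0)"
    and coeff_beta: "distributed P lborel (\<lambda>\<omega>. (\<alpha> i \<omega>)\<^sup>2) (\<lambda>u. ennreal (beta_density a b u))"
    and innov_ident: "t \<ge> 0 \<Longrightarrow> distr P borel (\<epsilon> i t) = distr P borel (\<epsilon> 0 0)"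
    and innov_integrable: "t \<ge> 0 \<Longrightarrow> integrable P (\<lambda>\<omega>. (\<epsilon> i t \<omega>)\<^sup>2)"
    and innov_mean: "t \<ge> 0 \<Longrightarrow> expectation (\<epsilon> i t) = 0"
    and innov_var: "t \<ge> 0 \<Longrightarrow> expectation (\<lambda>\<omega>. (\<epsilon> i t \<omega>)\<^sup>2) = \<sigma>\<^sup>2"
    and innov_pre: "t < 0 \<Longrightarrow> \<omega> \<in> space P \<Longrightarrow> \<epsilon> i t \<omega> = 0"
    and series_pre: "t < 0 \<Longrightarrow> \<omega> \<in> space P \<Longrightarrow> X i t \<omega> = 0"
    and series_rec: "\<omega> \<in> space P \<Longrightarrow> X i t \<omega> = \<alpha> i \<omega> * X i (t - 1) \<omega> + \<epsilon> i t \<omega>"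

definition cross_agg :: "(nat \<Rightarrow> int \<Rightarrow> 'p \<Rightarrow> real) \<Rightarrow> nat \<Rightarrow> int \<Rightarrow> 'p \<Rightarrow> real" where
  "cross_agg X N t \<omega> = (\<Sum>i<N. X i t \<omega>) / sqrt (real N)"

(* The limit as the cross-sectional dimension grows, in distribution at each date. *)
definition cross_agg_limit ::
  "'p measure \<Rightarrow> (nat \<Rightarrow> int \<Rightarrow> 'p \<Rightarrow> real) \<Rightarrow> 'q measure \<Rightarrow> (int \<Rightarrow> 'q \<Rightarrow> real) \<Rightarrow> bool" where
  "cross_agg_limit P X Q x \<longleftrightarrow>
     (\<forall>t. x t \<in> borel_measurable Q \<and>
          weak_conv_m (\<lambda>N. distr P borel (cross_agg X N t)) (distr Q borel (x t)))"

(* Type II: the innovations are i.i.d. from date 0 on and vanish before, so that the series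
   below has only finitely many nonzero terms. The coefficients carry the usual sign and
   scale normalisation. *)
locale type_II_ma = prob_space Q for Q :: "'q measure" +
  fixes \<phi> :: "nat \<Rightarrow> real"
    and \<nu> :: "int \<Rightarrow> 'q \<Rightarrow> real"
    and x :: "int \<Rightarrow> 'q \<Rightarrow> real"
  assumes coeff_zero: "\<phi> 0 = 1"
    and coeff_nonneg: "\<phi> j \<ge> 0"
    and innov_indep: "indep_vars (\<lambda>_. borel) \<nu> {0..}"
    and innov_ident: "t \<ge> 0 \<Longrightarrow> distr Q borel (\<nu> t) = distr Q borel (\<nu> 0)"
    and innov_integrable: "t \<ge> 0 \<Longrightarrow> integrable Q (\<lambda>\<omega>. (\<nu> t \<omega>)\<^sup>2)"
    and innov_mean: "t \<ge> 0 \<Longrightarrow> expectation (\<nu> t) = 0"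
    and innov_pre: "t < 0 \<Longrightarrow> \<omega> \<in> space Q \<Longrightarrow> \<nu> t \<omega> = 0"
    and ma: "\<omega> \<in> space Q \<Longrightarrow> (\<lambda>j. \<phi> j * \<nu> (t - int j) \<omega>) sums x t \<omega>"

(* Square-integrable (possibly nonlinear) measurable functions of the sample x_0, ..., x_T. *)
definition forecasts :: "'q measure \<Rightarrow> (int \<Rightarrow> 'q \<Rightarrow> real) \<Rightarrow> nat \<Rightarrow> ('q \<Rightarrow> real) set" where
  "forecasts Q x T =
     {f. integrable Q (\<lambda>\<omega>. (f \<omega>)\<^sup>2) \<and>
         (\<exists>g \<in> borel_measurable (Pi\<^sub>M {..T} (\<lambda>_. borel)).
            \<forall>\<omega>\<in>space Q. f \<omega> = g (\<lambda>t\<in>{..T}. x (int t) \<omega>))}"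

definition mmse_forecast ::
  "'q measure \<Rightarrow> (int \<Rightarrow> 'q \<Rightarrow> real) \<Rightarrow> nat \<Rightarrow> nat \<Rightarrow> ('q \<Rightarrow> real) \<Rightarrow> bool" where
  "mmse_forecast Q x T h f \<longleftrightarrow>
     f \<in> forecasts Q x T \<and>
     (\<forall>f'\<in>forecasts Q x T.
        (\<integral>\<omega>. (x (int (T + h)) \<omega> - f \<omega>)\<^sup>2 \<partial>Q) \<le> (\<integral>\<omega>. (x (int (T + h)) \<omega> - f' \<omega>)\<^sup>2 \<partial>Q))"

end

theory Submission
  imports Defs
begin

text \<open>
  The argument has two independent halves: the coefficients \<open>\<phi>\<close> are identified by comparing
  variances, and the optimality of the forecast is an orthogonality argument.

  Identification. For a Type II panel, \<open>X i t\<close> is the finite sum of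
  \<open>\<alpha> i ^ k * \<epsilon> i (t - k)\<close> over \<open>k \<le> t\<close>. Its terms are centred and pairwise orthogonal, because
  the coefficient and the innovations are independent, so that its variance is \<open>\<sigma>\<^sup>2\<close> times the sum
  of the even moments of \<open>\<alpha> i\<close>, the \<open>k\<close>-th one being \<open>Beta (a + k) b / Beta a b\<close>. At a fixed
  date the individual series are i.i.d., hence the central limit theorem makes the limit \<open>x t\<close>
  normal with exactly this variance (\<open>limit_second_moment\<close>). In the moving-average
  representation the variance of \<open>x t\<close> is that of the innovation times the sum of \<open>(\<phi> j)\<^sup>2\<close>
  over \<open>j \<le> t\<close>. The date \<open>0\<close> shows that the innovation variance is \<open>\<sigma>\<^sup>2\<close>, and differences of
  consecutive dates give each \<open>(\<phi> j)\<^sup>2\<close> (\<open>coeff_eq_sqrt\<close>). Although convergence is known only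
  date by date, the one-dimensional marginals thus already determine \<open>\<phi>\<close>.

  Optimality. Since \<open>\<phi> 0 = 1\<close>, the finite moving average can be inverted recursively, so the
  sample up to \<open>T\<close> and the innovations \<open>\<nu> 0, ..., \<nu> T\<close> are functions of each other. Splitting
  \<open>x (T + h)\<close> at the date \<open>T\<close> leaves the proposed forecast plus a centred remainder made of later
  innovations, which is independent of every function of the sample. The mean square error of any
  forecast therefore exceeds that of the proposed one by exactly the mean square of their
  difference (\<open>forecast_error_pythagoras\<close>), which yields both minimality and uniqueness.
\<close>

section \<open>Second moments of normal limits and of orthogonal sums\<close>


text \<open>
  Convergence in distribution alone does not transport second moments. Here it does, because the
  central limit theorem determines the whole limit law, and characteristic functions show that
  this law is unique.
\<close>

lemma (in prob_space) second_moment_of_clt_limit: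
  fixes Y :: "nat \<Rightarrow> 'a \<Rightarrow> real" and x :: "'b \<Rightarrow> real"
  assumes Y_indep: "indep_vars (\<lambda>i. borel) Y UNIV"
    and Y_mean: "\<And>n. expectation (Y n) = 0"
    and s_pos: "s > 0"
    and Y_sq: "\<And>n. integrable M (\<lambda>\<omega>. (Y n \<omega>)\<^sup>2)"
    and Y_var: "\<And>n. expectation (\<lambda>\<omega>. (Y n \<omega>)\<^sup>2) = s\<^sup>2"
    and Y_distr: "\<And>n. distr M borel (Y n) = \<mu>"
    and Q: "prob_space Q" and x [measurable]: "x \<in> borel_measurable Q"
    and conv: "weak_conv_m (\<lambda>n. distr M borel (\<lambda>\<omega>. (\<Sum>i<n. Y i \<omega>) / sqrt (real n))) (distr Q borel x)"
  shows "(\<integral>\<omega>. (x \<omega>)\<^sup>2 \<partial>Q) = s\<^sup>2"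
proof -
  interpret Q: prob_space Q by fact
  have [measurable]: "Y n \<in> borel_measurable M" for n
    using Y_indep unfolding indep_vars_def2 by simp
  have clt: "weak_conv_m (\<lambda>n. distr M borel (\<lambda>\<omega>. (\<Sum>i<n. Y i \<omega>) / sqrt (real n * s\<^sup>2)))
      std_normal_distribution"
    by (rule central_limit_theorem_zero_mean[OF Y_indep Y_mean s_pos Y_sq _ Y_distr])
      (simp add: Y_mean Y_var)
  \<comment> \<open>Passing from the standardized sums to the sums in \<open>conv\<close> rescales the frequency by \<open>s\<close>.\<close>
  have char_Q: "char (distr Q borel x) u = char std_normal_distribution (s * u)" for u
  proof (rule LIMSEQ_unique)
    show "(\<lambda>n. char (distr M borel (\<lambda>\<omega>. (\<Sum>i<n. Y i \<omega>) / sqrt (real n))) u)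
        \<longlonglongrightarrow> char (distr Q borel x) u"
      by (rule levy_continuity1[OF _ _ conv]) (auto intro!: real_distribution_distr Q.real_distribution_distr)
    have "(\<lambda>n. char (distr M borel (\<lambda>\<omega>. (\<Sum>i<n. Y i \<omega>) / sqrt (real n * s\<^sup>2))) (s * u))
        \<longlonglongrightarrow> char std_normal_distribution (s * u)"
      by (rule levy_continuity1[OF _ _ clt]) (auto intro!: real_distribution_distr real_dist_normal_dist)
    moreover have "char (distr M borel (\<lambda>\<omega>. (\<Sum>i<n. Y i \<omega>) / sqrt (real n * s\<^sup>2))) (s * u) =
        char (distr M borel (\<lambda>\<omega>. (\<Sum>i<n. Y i \<omega>) / sqrt (real n))) u" for n
      using s_pos by (simp add: char_def integral_distr real_sqrt_mult)
    ultimately show "(\<lambda>n. char (distr M borel (\<lambda>\<omega>. (\<Sum>i<n. Y i \<omega>) / sqrt (real n))) u)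
        \<longlonglongrightarrow> char std_normal_distribution (s * u)" by simp
  qed
  interpret N: real_distribution std_normal_distribution by (rule real_dist_normal_dist)
  have "distr Q borel x = distr std_normal_distribution borel (\<lambda>y. s * y)"
  proof (rule Levy_uniqueness)
    show "char (distr Q borel x) = char (distr std_normal_distribution borel (\<lambda>y. s * y))"
      unfolding fun_eq_iff char_Q by (simp add: char_def integral_distr mult_ac)
  qed (auto intro!: Q.real_distribution_distr N.real_distribution_distr)
  then have "(\<integral>y. y\<^sup>2 \<partial>distr Q borel x) = (\<integral>y. y\<^sup>2 \<partial>distr std_normal_distribution borel (\<lambda>y. s * y))"
    by simp
  then show ?thesis
    using std_normal_distribution_even_moments(1)[of 1]
    by (simp add: integral_distr power_mult_distrib)
qed

lemma expectation_square_orthogonal_sum: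
  fixes Y :: "'i \<Rightarrow> 'a \<Rightarrow> real"
  assumes "finite I"
    and sq: "\<And>i. i \<in> I \<Longrightarrow> integrable M (\<lambda>\<omega>. (Y i \<omega>)\<^sup>2)"
    and orth: "\<And>i j. i \<in> I \<Longrightarrow> j \<in> I \<Longrightarrow> i \<noteq> j \<Longrightarrow>
      integrable M (\<lambda>\<omega>. Y i \<omega> * Y j \<omega>) \<and> (\<integral>\<omega>. Y i \<omega> * Y j \<omega> \<partial>M) = 0"
  shows "integrable M (\<lambda>\<omega>. (\<Sum>i\<in>I. Y i \<omega>)\<^sup>2)"
    and "(\<integral>\<omega>. (\<Sum>i\<in>I. Y i \<omega>)\<^sup>2 \<partial>M) = (\<Sum>i\<in>I. \<integral>\<omega>. (Y i \<omega>)\<^sup>2 \<partial>M)"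
proof -
  have expand: "(\<Sum>i\<in>I. Y i \<omega>)\<^sup>2 = (\<Sum>i\<in>I. \<Sum>j\<in>I. Y i \<omega> * Y j \<omega>)" for \<omega>
    by (simp add: power2_eq_square sum_product)
  have int: "integrable M (\<lambda>\<omega>. Y i \<omega> * Y j \<omega>)" if "i \<in> I" "j \<in> I" for i j
    using orth[OF that] sq[OF that(1)] by (cases "i = j") (auto simp: power2_eq_square)
  show "integrable M (\<lambda>\<omega>. (\<Sum>i\<in>I. Y i \<omega>)\<^sup>2)"
    unfolding expand by (intro Bochner_Integration.integrable_sum int)
  have "(\<integral>\<omega>. (\<Sum>i\<in>I. Y i \<omega>)\<^sup>2 \<partial>M) = (\<Sum>i\<in>I. \<Sum>j\<in>I. \<integral>\<omega>. Y i \<omega> * Y j \<omega> \<partial>M)"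
    unfolding expand using int
    by (simp add: Bochner_Integration.integral_sum Bochner_Integration.integrable_sum)
  also have "\<dots> = (\<Sum>i\<in>I. \<Sum>j\<in>I. if j = i then \<integral>\<omega>. (Y i \<omega>)\<^sup>2 \<partial>M else 0)"
    using orth by (intro sum.cong refl) (auto simp: power2_eq_square)
  finally show "(\<integral>\<omega>. (\<Sum>i\<in>I. Y i \<omega>)\<^sup>2 \<partial>M) = (\<Sum>i\<in>I. \<integral>\<omega>. (Y i \<omega>)\<^sup>2 \<partial>M)"
    using \<open>finite I\<close> by simp
qed

text \<open>
  Each new index is regarded as a singleton block of old indices; injectivity makes the blocks
  disjoint.
\<close>

lemma (in prob_space) indep_vars_reindex_inj:
  assumes "indep_vars (\<lambda>_. N) Z I" "inj_on f J" "f ` J \<subseteq> I"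
  shows "indep_vars (\<lambda>_. N) (\<lambda>k. Z (f k)) J"
proof -
  have "indep_vars (\<lambda>j. PiM {f j} (\<lambda>_. N)) (\<lambda>j \<omega>. restrict (\<lambda>i. Z i \<omega>) {f j}) J"
    using assms by (intro indep_vars_restrict) (auto simp: disjoint_family_on_def inj_on_def)
  from indep_vars_compose2[OF this, of "\<lambda>j v. v (f j)" "\<lambda>_. N"]
  show ?thesis by simp
qed

section \<open>Random coefficients with a Beta distributed square\<close>

lemma Beta_pos:
  fixes a b :: real
  assumes "a > 0" "b > 0"
  shows "Beta a b > 0"
  using assms by (simp add: Beta_def Gamma_real_pos add_pos_pos)

text \<open>
  Multiplying the Beta density by \<open>u ^ k\<close> only shifts the first exponent, so the moment is a ratio
  of two Beta integrals.
\<close>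

lemma moment_of_beta_square:
  fixes A :: "'a \<Rightarrow> real"
  assumes pos: "a > 0" "b > 0"
    and beta: "distributed M lborel (\<lambda>\<omega>. (A \<omega>)\<^sup>2) (\<lambda>u. ennreal (beta_density a b u))"
  shows "(\<integral>\<omega>. A \<omega> ^ (2 * k) \<partial>M) = Beta (a + real k) b / Beta a b"
proof -
  have B: "Beta a b > 0" using pos by (rule Beta_pos)
  have nonneg: "0 \<le> beta_density a b u" for u using B by (simp add: beta_density_def)
  let ?f = "\<lambda>u. u powr (a + real k - 1) * (1 - u) powr (b - 1)"
  have hi: "(?f has_integral Beta (a + real k) b) {0<..<1}"
    using has_integral_Beta_real[of "a + real k" b] pos by (simp add: has_integral_Icc_iff_Ioo)
  have "(\<integral>u. ?f u * indicator {0<..<1} u \<partial>lborel) =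
      enn2real (\<integral>\<^sup>+u. ennreal (?f u) * indicator {0<..<1} u \<partial>lborel)"
    by (subst integral_eq_nn_integral)
      (auto intro!: arg_cong[where f = enn2real] nn_integral_cong split: split_indicator)
  also have "\<dots> = Beta (a + real k) b"
  proof -
    have "Beta (a + real k) b \<ge> 0" using hi by (rule has_integral_nonneg) auto
    then show ?thesis by (subst nn_integral_has_integral_lebesgue'[OF _ hi]) auto
  qed
  finally have val: "(\<integral>u. ?f u * indicator {0<..<1} u \<partial>lborel) = Beta (a + real k) b" .
  have "(\<integral>\<omega>. A \<omega> ^ (2 * k) \<partial>M) = (\<integral>u. beta_density a b u * u ^ k \<partial>lborel)"
    using distributed_integral[OF beta, of "\<lambda>u. u ^ k"] nonneg by (simp add: power_mult)
  also have "\<dots> = (\<integral>u. (?f u * indicator {0<..<1} u) / Beta a b \<partial>lborel)"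
  proof (intro Bochner_Integration.integral_cong refl)
    fix u :: real
    have "u powr (a - 1) * u ^ k = u powr (a + real k - 1)" if "0 < u"
      using that by (simp add: powr_realpow[symmetric] powr_add[symmetric] algebra_simps)
    then show "beta_density a b u * u ^ k = (?f u * indicator {0<..<1} u) / Beta a b"
      by (auto simp: beta_density_def mult_ac split: split_indicator)
  qed
  also have "\<dots> = Beta (a + real k) b / Beta a b"
    using val by simp
  finally show ?thesis .
qed

text \<open>This bound is what makes all powers of the coefficient, odd ones included, integrable.\<close>

lemma abs_le_1_of_beta_square:
  fixes A :: "'a \<Rightarrow> real"
  assumes beta: "distributed M lborel (\<lambda>\<omega>. (A \<omega>)\<^sup>2) (\<lambda>u. ennreal (beta_density a b u))"
  shows "AE \<omega> in M. \<bar>A \<omega>\<bar> \<le> 1"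
proof -
  have "AE u in distr M lborel (\<lambda>\<omega>. (A \<omega>)\<^sup>2). u \<le> 1"
    unfolding distributed_distr_eq_density[OF beta]
    using beta by (subst AE_density) (auto simp: distributed_def beta_density_def)
  then have "AE \<omega> in M. (A \<omega>)\<^sup>2 \<le> 1"
    using beta by (subst (asm) AE_distr_iff) (auto simp: distributed_def)
  then show ?thesis by (simp add: abs_square_le_1)
qed

section \<open>The individual series and the limit of their aggregate\<close>

text \<open>
  The random inputs of an individual are enumerated by the natural numbers, coefficient first, so
  that all individuals share one index set and their inputs can be compared in law.
\<close>

definition panel_index :: "nat \<Rightarrow> nat \<Rightarrow> nat + nat \<times> int" where
  "panel_index i k = (case k of 0 \<Rightarrow> Inl i | Suc s \<Rightarrow> Inr (i, int s))"

text \<open>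
  The value at date \<open>t\<close> of an autoregression started from \<open>0\<close>, as a function of its inputs in this
  order.
\<close>

definition ar_response :: "nat \<Rightarrow> (nat \<Rightarrow> real) \<Rightarrow> real" where
  "ar_response t v = (\<Sum>k\<le>t. v 0 ^ k * v (Suc (t - k)))"

lemma measurable_ar_response [measurable]:
  "ar_response t \<in> borel_measurable (Pi\<^sub>M UNIV (\<lambda>_. borel))"
  unfolding ar_response_def by measurable

context csa_panel
begin

definition own_input :: "nat \<Rightarrow> nat \<Rightarrow> 'p \<Rightarrow> real" where
  "own_input i k = case_sum \<alpha> (\<lambda>(i, t). \<epsilon> i t) (panel_index i k)"

lemma own_input_simps [simp]: "own_input i 0 = \<alpha> i" "own_input i (Suc s) = \<epsilon> i (int s)"
  by (simp_all add: own_input_def panel_index_def)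

lemma panel_index_range: "panel_index i k \<in> UNIV <+> UNIV \<times> {0..}"
  by (auto simp: panel_index_def split: nat.split)

lemma panel_index_eq_iff: "panel_index i k = panel_index j l \<longleftrightarrow> i = j \<and> k = l"
  by (auto simp: panel_index_def split: nat.splits)

lemma own_input_indep: "indep_vars (\<lambda>_. borel) (own_input i) UNIV"
  unfolding own_input_def using indep
  by (rule indep_vars_reindex_inj) (use panel_index_range in \<open>auto simp: inj_on_def panel_index_eq_iff\<close>)

lemma own_input_measurable [measurable]: "own_input i k \<in> borel_measurable P"
  using own_input_indep[of i] by (auto simp: indep_vars_def2)

lemma measurable_coeff [measurable]: "\<alpha> i \<in> borel_measurable P"
  using own_input_measurable[of i 0] by simp

lemma series_eq_ar_response:
  assumes "\<omega> \<in> space P"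
  shows "X i (int t) \<omega> = ar_response t (\<lambda>k. own_input i k \<omega>)"
proof (induction t)
  case 0
  show ?case using series_rec[OF assms, of i 0] series_pre[of "- 1" \<omega> i] assms
    by (simp add: ar_response_def)
next
  case (Suc t)
  then show ?case using series_rec[OF assms, of i "int (Suc t)"]
    by (simp add: ar_response_def sum.atMost_Suc_shift sum_distrib_left mult.assoc del: sum.atMost_Suc)
qed

text \<open>Different individuals draw on disjoint blocks of the jointly independent inputs.\<close>

lemma response_indep:
  "indep_vars (\<lambda>_. borel) (\<lambda>i \<omega>. ar_response t (\<lambda>k. own_input i k \<omega>)) UNIV"
proof -
  let ?K = "\<lambda>i. range (panel_index i)"
  let ?Z = "case_sum \<alpha> (\<lambda>(i, t). \<epsilon> i t)"
  have "indep_vars (\<lambda>i. PiM (?K i) (\<lambda>_. borel)) (\<lambda>i \<omega>. restrict (\<lambda>z. ?Z z \<omega>) (?K i)) UNIV"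
    using indep by (rule indep_vars_restrict)
      (use panel_index_range in \<open>auto simp: disjoint_family_on_def panel_index_eq_iff\<close>)
  then have "indep_vars (\<lambda>_. borel) (\<lambda>i \<omega>. ar_response t (\<lambda>k. restrict (\<lambda>z. ?Z z \<omega>) (?K i) (panel_index i k))) UNIV"
    by (rule indep_vars_compose2[where Y = "\<lambda>i v. ar_response t (\<lambda>k. v (panel_index i k))"])
      (simp add: ar_response_def)
  then show ?thesis by (simp add: own_input_def)
qed

text \<open>
  The inputs of each individual are independent with marginals that do not depend on the
  individual, so their joint law is the same product measure.
\<close>

lemma response_ident:
  "distr P borel (\<lambda>\<omega>. ar_response t (\<lambda>k. own_input i k \<omega>)) =
   distr P borel (\<lambda>\<omega>. ar_response t (\<lambda>k. own_input 0 k \<omega>))"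
proof -
  let ?B = "Pi\<^sub>M UNIV (\<lambda>_. borel) :: (nat \<Rightarrow> real) measure"
  have joint: "distr P ?B (\<lambda>\<omega> k. own_input j k \<omega>) = (\<Pi>\<^sub>M k\<in>UNIV. distr P borel (own_input j k))" for j
    using indep_vars_iff_distr_eq_PiM[where I = UNIV and M' = "\<lambda>_. borel" and X = "own_input j"] own_input_indep[of j]
    by (simp add: restrict_UNIV)
  have "distr P borel (own_input i k) = distr P borel (own_input 0 k)" for k
    using innov_ident[of "int (k - 1)" i] innov_ident[of "int (k - 1)" 0] coeff_ident[of i]
    by (cases k) auto
  then have eq: "distr P ?B (\<lambda>\<omega> k. own_input i k \<omega>) = distr P ?B (\<lambda>\<omega> k. own_input 0 k \<omega>)"
    by (simp add: joint)
  have [measurable]: "(\<lambda>\<omega> k. own_input j k \<omega>) \<in> measurable P ?B" for j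
    by (rule measurable_PiM_single') auto
  have "distr P borel (\<lambda>\<omega>. ar_response t (\<lambda>k. own_input j k \<omega>)) =
      distr (distr P ?B (\<lambda>\<omega> k. own_input j k \<omega>)) borel (ar_response t)" for j
    by (subst distr_distr) (auto simp: comp_def)
  then show ?thesis using eq by simp
qed

lemma integrable_coeff_power: "integrable P (\<lambda>\<omega>. \<alpha> i \<omega> ^ n)"
proof (rule integrable_const_bound[of _ 1])
  show "AE \<omega> in P. norm (\<alpha> i \<omega> ^ n) \<le> 1"
    using abs_le_1_of_beta_square[OF coeff_beta, of i]
    by eventually_elim (simp add: power_abs power_le_one)
qed simp

lemma integrable_innov: "integrable P (\<epsilon> i (int s))"
  using own_input_measurable[of i "Suc s"] innov_integrable[of "int s" i]
  by (auto dest: square_integrable_imp_integrable[of "\<epsilon> i (int s)"])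

text \<open>
  The expectation factors over the three distinct inputs involved, and an innovation has mean
  zero.
\<close>

lemma response_terms_orthogonal:
  assumes "p \<noteq> q"
  shows "integrable P (\<lambda>\<omega>. \<alpha> i \<omega> ^ n * \<epsilon> i (int p) \<omega> * \<epsilon> i (int q) \<omega>)"
    and "expectation (\<lambda>\<omega>. \<alpha> i \<omega> ^ n * \<epsilon> i (int p) \<omega> * \<epsilon> i (int q) \<omega>) = 0"
proof -
  let ?I = "{0, Suc p, Suc q}"
  define Y where "Y k \<omega> = (if k = 0 then own_input i k \<omega> ^ n else own_input i k \<omega>)" for k \<omega>
  have ind: "indep_vars (\<lambda>_. borel) Y ?I"
    unfolding Y_def
    by (rule indep_vars_compose2[OF indep_vars_subset[OF own_input_indep],
          where Y = "\<lambda>k y. if k = 0 then y ^ n else y"]) auto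
  have int: "integrable P (Y k)" if "k \<in> ?I" for k
    using that integrable_coeff_power[of i n] integrable_innov[of i] by (auto simp: Y_def[abs_def])
  have prod: "(\<Prod>k\<in>?I. Y k \<omega>) = \<alpha> i \<omega> ^ n * \<epsilon> i (int p) \<omega> * \<epsilon> i (int q) \<omega>" for \<omega>
    using assms by (simp add: Y_def)
  show "integrable P (\<lambda>\<omega>. \<alpha> i \<omega> ^ n * \<epsilon> i (int p) \<omega> * \<epsilon> i (int q) \<omega>)"
    using indep_vars_integrable[OF _ ind int] by (simp add: prod)
  have "expectation (\<lambda>\<omega>. \<Prod>k\<in>?I. Y k \<omega>) = (\<Prod>k\<in>?I. expectation (Y k))"
    by (rule indep_vars_lebesgue_integral[OF _ ind int]) auto
  moreover have "expectation (Y (Suc p)) = 0"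
    using innov_mean[of "int p" i] by (simp add: Y_def[abs_def])
  ultimately show "expectation (\<lambda>\<omega>. \<alpha> i \<omega> ^ n * \<epsilon> i (int p) \<omega> * \<epsilon> i (int q) \<omega>) = 0"
    unfolding prod by (simp add: prod_zero_iff) 
qed

lemma response_term_square:
  assumes "a > 0" "b > 0"
  shows "integrable P (\<lambda>\<omega>. (\<alpha> i \<omega> ^ k * \<epsilon> i (int p) \<omega>)\<^sup>2)"
    and "expectation (\<lambda>\<omega>. (\<alpha> i \<omega> ^ k * \<epsilon> i (int p) \<omega>)\<^sup>2) = Beta (a + real k) b / Beta a b * \<sigma>\<^sup>2"
proof -
  let ?I = "{0, Suc p}"
  define Y where "Y j \<omega> = (if j = 0 then own_input i j \<omega> ^ (2 * k) else (own_input i j \<omega>)\<^sup>2)" for j \<omega>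
  have ind: "indep_vars (\<lambda>_. borel) Y ?I"
    unfolding Y_def
    by (rule indep_vars_compose2[OF indep_vars_subset[OF own_input_indep],
          where Y = "\<lambda>j y. if j = 0 then y ^ (2 * k) else y\<^sup>2"]) auto
  have int: "integrable P (Y j)" if "j \<in> ?I" for j
    using that integrable_coeff_power[of i] innov_integrable[of "int p" i] by (auto simp: Y_def[abs_def])
  have prod: "(\<Prod>j\<in>?I. Y j \<omega>) = (\<alpha> i \<omega> ^ k * \<epsilon> i (int p) \<omega>)\<^sup>2" for \<omega>
    by (simp add: Y_def power_mult_distrib power_mult[symmetric] mult.commute)
  show "integrable P (\<lambda>\<omega>. (\<alpha> i \<omega> ^ k * \<epsilon> i (int p) \<omega>)\<^sup>2)"
    using indep_vars_integrable[OF _ ind int] by (simp add: prod)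
  have "expectation (\<lambda>\<omega>. \<Prod>j\<in>?I. Y j \<omega>) = (\<Prod>j\<in>?I. expectation (Y j))"
    by (rule indep_vars_lebesgue_integral[OF _ ind int]) auto
  then show "expectation (\<lambda>\<omega>. (\<alpha> i \<omega> ^ k * \<epsilon> i (int p) \<omega>)\<^sup>2) = Beta (a + real k) b / Beta a b * \<sigma>\<^sup>2"
    unfolding prod using moment_of_beta_square[OF assms coeff_beta, of i k] innov_var[of "int p" i]
    by (simp add: Y_def[abs_def])
qed

lemma response_second_moment:
  assumes "a > 0" "b > 0"
  shows "integrable P (\<lambda>\<omega>. (ar_response t (\<lambda>k. own_input i k \<omega>))\<^sup>2)"
    and "expectation (\<lambda>\<omega>. (ar_response t (\<lambda>k. own_input i k \<omega>))\<^sup>2) =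
      \<sigma>\<^sup>2 * (\<Sum>k\<le>t. Beta (a + real k) b / Beta a b)"
proof -
  define Y where "Y k \<omega> = \<alpha> i \<omega> ^ k * \<epsilon> i (int (t - k)) \<omega>" for k \<omega>
  have resp: "ar_response t (\<lambda>k. own_input i k \<omega>) = (\<Sum>k\<le>t. Y k \<omega>)" for \<omega>
    by (simp add: ar_response_def Y_def)
  have sq: "integrable P (\<lambda>\<omega>. (Y k \<omega>)\<^sup>2)" for k
    unfolding Y_def by (rule response_term_square[OF assms])
  have mixed: "Y k \<omega> * Y l \<omega> = \<alpha> i \<omega> ^ (k + l) * \<epsilon> i (int (t - k)) \<omega> * \<epsilon> i (int (t - l)) \<omega>" for k l \<omega>
    by (simp add: Y_def power_add mult_ac)
  have orth: "integrable P (\<lambda>\<omega>. Y k \<omega> * Y l \<omega>) \<and> expectation (\<lambda>\<omega>. Y k \<omega> * Y l \<omega>) = 0"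
    if "k \<in> {..t}" "l \<in> {..t}" "k \<noteq> l" for k l
    unfolding mixed using that by (intro conjI response_terms_orthogonal) auto
  note sum = expectation_square_orthogonal_sum[OF _ sq orth, of "{..t}"]
  show "integrable P (\<lambda>\<omega>. (ar_response t (\<lambda>k. own_input i k \<omega>))\<^sup>2)"
    unfolding resp by (rule sum) auto
  have "expectation (\<lambda>\<omega>. (ar_response t (\<lambda>k. own_input i k \<omega>))\<^sup>2) = (\<Sum>k\<le>t. expectation (\<lambda>\<omega>. (Y k \<omega>)\<^sup>2))"
    unfolding resp by (rule sum) auto
  then show "expectation (\<lambda>\<omega>. (ar_response t (\<lambda>k. own_input i k \<omega>))\<^sup>2) =
      \<sigma>\<^sup>2 * (\<Sum>k\<le>t. Beta (a + real k) b / Beta a b)"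
    unfolding Y_def response_term_square[OF assms] by (simp add: sum_distrib_left mult.commute)
qed

lemma response_mean: "expectation (\<lambda>\<omega>. ar_response t (\<lambda>k. own_input i k \<omega>)) = 0"
proof -
  have ind: "indep_var borel (\<lambda>\<omega>. \<alpha> i \<omega> ^ k) borel (\<epsilon> i (int p))" for k p
  proof -
    have "indep_var (PiM {0} (\<lambda>_. borel)) (\<lambda>\<omega>. restrict (\<lambda>j. own_input i j \<omega>) {0})
        (PiM {Suc p} (\<lambda>_. borel)) (\<lambda>\<omega>. restrict (\<lambda>j. own_input i j \<omega>) {Suc p})"
      by (rule indep_var_restrict[OF own_input_indep]) auto
    from indep_var_compose[OF this, of "\<lambda>v. v 0 ^ k" borel "\<lambda>v. v (Suc p)" borel]
    show ?thesis by (simp add: comp_def)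
  qed
  have zero: "expectation (\<lambda>\<omega>. \<alpha> i \<omega> ^ k * \<epsilon> i (int p) \<omega>) = 0"
    and int: "integrable P (\<lambda>\<omega>. \<alpha> i \<omega> ^ k * \<epsilon> i (int p) \<omega>)" for k p
    using indep_var_lebesgue_integral[OF ind integrable_coeff_power integrable_innov]
      indep_var_integrable[OF ind integrable_coeff_power integrable_innov] innov_mean[of "int p" i]
    by auto
  show ?thesis
    unfolding ar_response_def own_input_simps Bochner_Integration.integral_sum[OF int] zero by simp
qed

text \<open>
  The left side of the variance comparison that identifies the moving-average coefficients: the
  individual series at date \<open>t\<close> satisfy the hypotheses of the central limit theorem.
\<close>

lemma limit_second_moment:
  assumes "a > 0" "b > 0" "\<sigma> > 0" and Q: "prob_space Q"
    and lim: "cross_agg_limit P X Q x"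
  shows "(\<integral>\<omega>. (x (int t) \<omega>)\<^sup>2 \<partial>Q) = \<sigma>\<^sup>2 * (\<Sum>k\<le>t. Beta (a + real k) b / Beta a b)"
proof -
  define V where "V = (\<Sum>k\<le>t. Beta (a + real k) b / Beta a b)"
  have Bpos: "Beta (a + real k) b > 0" for k
    using assms by (intro Beta_pos) auto
  \<comment> \<open>The limit is not degenerate, so the central limit theorem applies.\<close>
  have "V > 0"
    unfolding V_def using Bpos Bpos[of 0] by (intro sum_pos) auto
  let ?R = "\<lambda>i \<omega>. ar_response t (\<lambda>k. own_input i k \<omega>)"
  have eq: "distr P borel (cross_agg X n (int t)) = distr P borel (\<lambda>\<omega>. (\<Sum>i<n. ?R i \<omega>) / sqrt (real n))" for n
    by (intro distr_cong) (auto simp: cross_agg_def series_eq_ar_response)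
  have conv: "weak_conv_m (\<lambda>n. distr P borel (\<lambda>\<omega>. (\<Sum>i<n. ?R i \<omega>) / sqrt (real n)))
      (distr Q borel (x (int t)))"
    unfolding eq[symmetric] using lim by (simp add: cross_agg_limit_def)
  have "(\<integral>\<omega>. (x (int t) \<omega>)\<^sup>2 \<partial>Q) = (\<sigma> * sqrt V)\<^sup>2"
  proof (rule second_moment_of_clt_limit[OF response_indep response_mean _ _ _ response_ident Q _ conv])
    show "\<sigma> * sqrt V > 0" using \<open>\<sigma> > 0\<close> \<open>V > 0\<close> by simp
    show "expectation (\<lambda>\<omega>. (?R i \<omega>)\<^sup>2) = (\<sigma> * sqrt V)\<^sup>2" for i
      using response_second_moment(2)[OF assms(1,2), of t i] \<open>V > 0\<close>
      by (simp add: power_mult_distrib V_def)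
  qed (use lim response_second_moment(1)[OF assms(1,2)] in \<open>auto simp: cross_agg_limit_def\<close>)
  then show ?thesis using \<open>V > 0\<close> by (simp add: power_mult_distrib V_def)
qed

end

section \<open>The moving average and its innovations\<close>

lemma integrable_square_diff:
  fixes f g :: "'a \<Rightarrow> real"
  assumes [measurable]: "f \<in> borel_measurable M" "g \<in> borel_measurable M"
    and "integrable M (\<lambda>\<omega>. (f \<omega>)\<^sup>2)" "integrable M (\<lambda>\<omega>. (g \<omega>)\<^sup>2)"
  shows "integrable M (\<lambda>\<omega>. (f \<omega> - g \<omega>)\<^sup>2)"
proof (rule Bochner_Integration.integrable_bound)
  show "integrable M (\<lambda>\<omega>. 2 * (f \<omega>)\<^sup>2 + 2 * (g \<omega>)\<^sup>2)"
    using assms by simp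
  have "(u - v)\<^sup>2 \<le> 2 * u\<^sup>2 + 2 * v\<^sup>2" for u v :: real
    using zero_le_power2[of "u + v"] by (simp add: power2_sum power2_diff)
  then show "AE \<omega> in M. norm ((f \<omega> - g \<omega>)\<^sup>2) \<le> norm (2 * (f \<omega>)\<^sup>2 + 2 * (g \<omega>)\<^sup>2)"
    by simp
qed simp

context type_II_ma
begin

lemma innov_measurable: "t \<ge> 0 \<Longrightarrow> \<nu> t \<in> borel_measurable Q"
  using innov_indep by (auto simp: indep_vars_def2)

lemma integrable_innov: "t \<ge> 0 \<Longrightarrow> integrable Q (\<nu> t)"
  by (rule square_integrable_imp_integrable[OF innov_measurable innov_integrable])

lemma innov_second_moment:
  assumes "t \<ge> 0"
  shows "expectation (\<lambda>\<omega>. (\<nu> t \<omega>)\<^sup>2) = expectation (\<lambda>\<omega>. (\<nu> 0 \<omega>)\<^sup>2)"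
proof -
  have "(\<integral>y. y\<^sup>2 \<partial>distr Q borel (\<nu> t)) = (\<integral>y. y\<^sup>2 \<partial>distr Q borel (\<nu> 0))"
    using innov_ident[OF assms] by simp
  then show ?thesis
    using innov_measurable[OF assms] innov_measurable[of 0] by (simp add: integral_distr)
qed

lemma linear_combination_second_moment:
  fixes c :: "'j \<Rightarrow> real" and f :: "'j \<Rightarrow> int"
  assumes "finite J" "inj_on f J" "\<And>j. j \<in> J \<Longrightarrow> f j \<ge> 0"
  shows "integrable Q (\<lambda>\<omega>. (\<Sum>j\<in>J. c j * \<nu> (f j) \<omega>)\<^sup>2)"
    and "expectation (\<lambda>\<omega>. (\<Sum>j\<in>J. c j * \<nu> (f j) \<omega>)\<^sup>2) =
      expectation (\<lambda>\<omega>. (\<nu> 0 \<omega>)\<^sup>2) * (\<Sum>j\<in>J. (c j)\<^sup>2)"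
proof -
  have sq: "integrable Q (\<lambda>\<omega>. (c j * \<nu> (f j) \<omega>)\<^sup>2)" if "j \<in> J" for j
    using innov_integrable[OF assms(3)[OF that]] by (simp add: power_mult_distrib)
  have orth: "integrable Q (\<lambda>\<omega>. c i * \<nu> (f i) \<omega> * (c j * \<nu> (f j) \<omega>)) \<and>
      expectation (\<lambda>\<omega>. c i * \<nu> (f i) \<omega> * (c j * \<nu> (f j) \<omega>)) = 0"
    if "i \<in> J" "j \<in> J" "i \<noteq> j" for i j
  proof -
    have ne: "f i \<noteq> f j" using assms(2) that by (auto simp: inj_on_def)
    have ind: "indep_vars (\<lambda>_. borel) \<nu> {f i, f j}"
      using assms(3) that by (intro indep_vars_subset[OF innov_indep]) auto
    have int: "integrable Q (\<nu> k)" if "k \<in> {f i, f j}" for k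
      using that assms(3) \<open>i \<in> J\<close> \<open>j \<in> J\<close> by (auto intro: integrable_innov)
    have split: "c i * \<nu> (f i) \<omega> * (c j * \<nu> (f j) \<omega>) = c i * c j * (\<Prod>k\<in>{f i, f j}. \<nu> k \<omega>)" for \<omega>
      using ne by simp
    have "expectation (\<lambda>\<omega>. \<Prod>k\<in>{f i, f j}. \<nu> k \<omega>) = (\<Prod>k\<in>{f i, f j}. expectation (\<nu> k))"
      by (rule indep_vars_lebesgue_integral[OF _ ind int]) auto
    also have "\<dots> = 0"
      using innov_mean[of "f i"] assms(3) that by simp
    finally show ?thesis
      unfolding split using indep_vars_integrable[OF _ ind int] by simp
  qed
  show "integrable Q (\<lambda>\<omega>. (\<Sum>j\<in>J. c j * \<nu> (f j) \<omega>)\<^sup>2)"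
    by (rule expectation_square_orthogonal_sum[OF \<open>finite J\<close> sq orth])
  have "expectation (\<lambda>\<omega>. (\<Sum>j\<in>J. c j * \<nu> (f j) \<omega>)\<^sup>2) = (\<Sum>j\<in>J. expectation (\<lambda>\<omega>. (c j * \<nu> (f j) \<omega>)\<^sup>2))"
    by (rule expectation_square_orthogonal_sum[OF \<open>finite J\<close> sq orth])
  also have "\<dots> = (\<Sum>j\<in>J. expectation (\<lambda>\<omega>. (\<nu> 0 \<omega>)\<^sup>2) * (c j)\<^sup>2)"
  proof (intro sum.cong refl)
    fix j assume "j \<in> J"
    then show "expectation (\<lambda>\<omega>. (c j * \<nu> (f j) \<omega>)\<^sup>2) = expectation (\<lambda>\<omega>. (\<nu> 0 \<omega>)\<^sup>2) * (c j)\<^sup>2"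
      using innov_second_moment[OF assms(3)] by (simp add: power_mult_distrib)
  qed
  finally show "expectation (\<lambda>\<omega>. (\<Sum>j\<in>J. c j * \<nu> (f j) \<omega>)\<^sup>2) =
      expectation (\<lambda>\<omega>. (\<nu> 0 \<omega>)\<^sup>2) * (\<Sum>j\<in>J. (c j)\<^sup>2)"
    by (simp add: sum_distrib_left)
qed

lemma ma_finite:
  assumes "\<omega> \<in> space Q"
  shows "x (int t) \<omega> = (\<Sum>j\<le>t. \<phi> j * \<nu> (int t - int j) \<omega>)"
proof (rule sums_unique2[OF ma[OF assms]])
  show "(\<lambda>j. \<phi> j * \<nu> (int t - int j) \<omega>) sums (\<Sum>j\<le>t. \<phi> j * \<nu> (int t - int j) \<omega>)"
    using innov_pre assms by (intro sums_finite) auto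
qed

lemma innov_recursion:
  assumes "\<omega> \<in> space Q"
  shows "\<nu> (int i) \<omega> = x (int i) \<omega> - (\<Sum>j=1..i. \<phi> j * \<nu> (int i - int j) \<omega>)"
proof -
  have "{..i} = insert 0 {1..i}" by auto
  then show ?thesis using ma_finite[OF assms, of i] by (simp add: coeff_zero)
qed

text \<open>The right side of the variance comparison.\<close>

lemma second_moment:
  "expectation (\<lambda>\<omega>. (x (int t) \<omega>)\<^sup>2) = expectation (\<lambda>\<omega>. (\<nu> 0 \<omega>)\<^sup>2) * (\<Sum>j\<le>t. (\<phi> j)\<^sup>2)"
proof -
  have "expectation (\<lambda>\<omega>. (x (int t) \<omega>)\<^sup>2) = expectation (\<lambda>\<omega>. (\<Sum>j\<le>t. \<phi> j * \<nu> (int t - int j) \<omega>)\<^sup>2)"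
    by (intro Bochner_Integration.integral_cong) (simp_all add: ma_finite)
  also have "\<dots> = expectation (\<lambda>\<omega>. (\<nu> 0 \<omega>)\<^sup>2) * (\<Sum>j\<le>t. (\<phi> j)\<^sup>2)"
    by (rule linear_combination_second_moment) (auto simp: inj_on_def)
  finally show ?thesis .
qed

text \<open>
  The date \<open>0\<close> fixes the scale, as \<open>\<phi> 0 = 1\<close> and \<open>r 0 = 1\<close>; increments of the partial sums then
  give the squares, and the sign convention on \<open>\<phi>\<close> selects the root.
\<close>

lemma coeff_eq_sqrt:
  assumes moments: "\<And>t. expectation (\<lambda>\<omega>. (x (int t) \<omega>)\<^sup>2) = v * (\<Sum>k\<le>t. r k)"
    and "v > 0" "r 0 = 1"
  shows "\<phi> j = sqrt (r j)"
proof -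
  let ?s = "expectation (\<lambda>\<omega>. (\<nu> 0 \<omega>)\<^sup>2)"
  have sums: "?s * (\<Sum>k\<le>t. (\<phi> k)\<^sup>2) = v * (\<Sum>k\<le>t. r k)" for t
    using moments[of t] second_moment[of t] by simp
  have "?s = v" using sums[of 0] assms(3) by (simp add: coeff_zero)
  then have eq: "(\<Sum>k\<le>t. (\<phi> k)\<^sup>2) = (\<Sum>k\<le>t. r k)" for t
    using sums[of t] \<open>v > 0\<close> by simp
  have "(\<phi> j)\<^sup>2 = r j"
  proof (cases j)
    case 0 then show ?thesis using eq[of 0] by simp
  next
    case (Suc m) then show ?thesis using eq[of m] eq[of j] by simp
  qed
  then show ?thesis using coeff_nonneg by (rule real_sqrt_unique[symmetric])
qed

text \<open>
  The recursion \<open>innov_recursion\<close> expresses each innovation through the observation of its date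
  and earlier innovations, so measurability in the sample propagates forward.
\<close>

lemma innov_from_sample:
  "i \<le> T \<Longrightarrow> \<exists>g \<in> borel_measurable (Pi\<^sub>M {..T} (\<lambda>_. borel)).
     \<forall>\<omega>\<in>space Q. \<nu> (int i) \<omega> = g (\<lambda>t\<in>{..T}. x (int t) \<omega>)"
proof (induction i rule: less_induct)
  case (less i)
  have "\<forall>k\<in>{..<i}. \<exists>g. g \<in> borel_measurable (Pi\<^sub>M {..T} (\<lambda>_. borel)) \<and>
     (\<forall>\<omega>\<in>space Q. \<nu> (int k) \<omega> = g (\<lambda>t\<in>{..T}. x (int t) \<omega>))"
  proof
    fix k assume "k \<in> {..<i}"
    then have "k < i" "k \<le> T" using less.prems by auto
    from less.IH[OF this]
    show "\<exists>g. g \<in> borel_measurable (Pi\<^sub>M {..T} (\<lambda>_. borel)) \<and>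
        (\<forall>\<omega>\<in>space Q. \<nu> (int k) \<omega> = g (\<lambda>t\<in>{..T}. x (int t) \<omega>))"
      unfolding Bex_def .
  qed
  from bchoice[OF this] obtain G where G: "\<And>k. k < i \<Longrightarrow> G k \<in> borel_measurable (Pi\<^sub>M {..T} (\<lambda>_. borel))"
    and eq: "\<And>k \<omega>. k < i \<Longrightarrow> \<omega> \<in> space Q \<Longrightarrow> \<nu> (int k) \<omega> = G k (\<lambda>t\<in>{..T}. x (int t) \<omega>)"
    by auto
  define g where "g v = v i - (\<Sum>j=1..i. \<phi> j * G (i - j) v)" for v
  have "g \<in> borel_measurable (Pi\<^sub>M {..T} (\<lambda>_. borel))"
    unfolding g_def using less.prems
    by (intro borel_measurable_diff borel_measurable_sum borel_measurable_times G) auto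
  moreover have "\<nu> (int i) \<omega> = g (\<lambda>t\<in>{..T}. x (int t) \<omega>)" if "\<omega> \<in> space Q" for \<omega>
  proof -
    have "\<phi> j * \<nu> (int i - int j) \<omega> = \<phi> j * G (i - j) (\<lambda>t\<in>{..T}. x (int t) \<omega>)" if "j \<in> {1..i}" for j
      using eq[of "i - j" \<omega>] that \<open>\<omega> \<in> space Q\<close> by (simp add: of_nat_diff)
    then have "(\<Sum>j=1..i. \<phi> j * \<nu> (int i - int j) \<omega>) =
        (\<Sum>j=1..i. \<phi> j * G (i - j) (\<lambda>t\<in>{..T}. x (int t) \<omega>))"
      by (rule sum.cong[OF refl])
    then show ?thesis
      unfolding innov_recursion[OF that, of i] using less.prems by (simp add: g_def)
  qed
  ultimately show ?case by blast
qed

section \<open>Optimality of the forecast\<close>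

definition ma_forecast :: "nat \<Rightarrow> nat \<Rightarrow> 'q \<Rightarrow> real" where
  "ma_forecast T h \<omega> = (\<Sum>j=h..T + h. \<phi> j * \<nu> (int T - int j + int h) \<omega>)"

lemma ma_forecast_in_forecasts: "ma_forecast T h \<in> forecasts Q x T"
proof -
  have "\<forall>i\<in>{..T}. \<exists>g. g \<in> borel_measurable (Pi\<^sub>M {..T} (\<lambda>_. borel)) \<and>
     (\<forall>\<omega>\<in>space Q. \<nu> (int i) \<omega> = g (\<lambda>t\<in>{..T}. x (int t) \<omega>))"
    using innov_from_sample by blast
  from bchoice[OF this] obtain G where G: "\<And>k. k \<le> T \<Longrightarrow> G k \<in> borel_measurable (Pi\<^sub>M {..T} (\<lambda>_. borel))"
    and eq: "\<And>k \<omega>. k \<le> T \<Longrightarrow> \<omega> \<in> space Q \<Longrightarrow> \<nu> (int k) \<omega> = G k (\<lambda>t\<in>{..T}. x (int t) \<omega>)"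
    by auto
  define g where "g v = (\<Sum>j=h..T + h. \<phi> j * G (T + h - j) v)" for v
  have "g \<in> borel_measurable (Pi\<^sub>M {..T} (\<lambda>_. borel))"
    unfolding g_def by (intro borel_measurable_sum borel_measurable_times G) auto
  moreover have "ma_forecast T h \<omega> = g (\<lambda>t\<in>{..T}. x (int t) \<omega>)" if "\<omega> \<in> space Q" for \<omega>
    unfolding ma_forecast_def g_def
  proof (intro sum.cong refl)
    fix j assume "j \<in> {h..T + h}"
    then have "int T - int j + int h = int (T + h - j)" "T + h - j \<le> T" by auto
    then show "\<phi> j * \<nu> (int T - int j + int h) \<omega> = \<phi> j * G (T + h - j) (\<lambda>t\<in>{..T}. x (int t) \<omega>)"
      using eq[of "T + h - j" \<omega>] that by simp
  qed
  moreover have "integrable Q (\<lambda>\<omega>. (ma_forecast T h \<omega>)\<^sup>2)"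
    unfolding ma_forecast_def by (rule linear_combination_second_moment) (auto simp: inj_on_def)
  ultimately show ?thesis unfolding forecasts_def by blast
qed

text \<open>
  The forecast error splits into a part that involves innovations after \<open>T\<close> only and the
  difference of two functions of the sample. The first is centred and independent of the second,
  so the mixed term vanishes.
\<close>

lemma forecast_error_pythagoras:
  assumes "f \<in> forecasts Q x T"
  shows "integrable Q (\<lambda>\<omega>. (ma_forecast T h \<omega> - f \<omega>)\<^sup>2)"
    and "expectation (\<lambda>\<omega>. (x (int (T + h)) \<omega> - f \<omega>)\<^sup>2) =
      expectation (\<lambda>\<omega>. (x (int (T + h)) \<omega> - ma_forecast T h \<omega>)\<^sup>2) +
      expectation (\<lambda>\<omega>. (ma_forecast T h \<omega> - f \<omega>)\<^sup>2)"
proof -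
  from assms obtain g where g_meas: "g \<in> borel_measurable (Pi\<^sub>M {..T} (\<lambda>_. borel))"
    and g: "\<And>\<omega>. \<omega> \<in> space Q \<Longrightarrow> f \<omega> = g (\<lambda>t\<in>{..T}. x (int t) \<omega>)"
    and f_sq: "integrable Q (\<lambda>\<omega>. (f \<omega>)\<^sup>2)"
    by (auto simp: forecasts_def)
  \<comment> \<open>As functions of the path of innovations: the unpredictable part \<open>e\<close> of \<open>x (T + h)\<close>, which reads
    only dates after \<open>T\<close>, and the two forecasts \<open>F\<close> and \<open>G\<close>, which read only dates in \<open>0..T\<close>.\<close>
  define e where "e v = (\<Sum>j<h. \<phi> j * v (int (T + h) - int j))" for v :: "int \<Rightarrow> real"
  define F where "F v = (\<Sum>j=h..T + h. \<phi> j * v (int T - int j + int h))" for v :: "int \<Rightarrow> real"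
  define G where "G v = g (\<lambda>t\<in>{..T}. \<Sum>j\<le>t. \<phi> j * v (int t - int j))" for v :: "int \<Rightarrow> real"
  let ?A = "{int T<..}" and ?B = "{0..int T}"
  define E where "E \<omega> = e (restrict (\<lambda>t. \<nu> t \<omega>) ?A)" for \<omega>
  define D where "D \<omega> = F (restrict (\<lambda>t. \<nu> t \<omega>) ?B) - G (restrict (\<lambda>t. \<nu> t \<omega>) ?B)" for \<omega>
  have F_meas: "F \<in> borel_measurable (PiM ?B (\<lambda>_. borel))"
    unfolding F_def by (intro borel_measurable_sum borel_measurable_times measurable_component_singleton) auto
  have G_meas: "G \<in> borel_measurable (PiM ?B (\<lambda>_. borel))"
    unfolding G_def
    by (intro measurable_compose[OF measurable_restrict g_meas] borel_measurable_sum
        borel_measurable_times measurable_component_singleton) auto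
  have e_meas: "e \<in> borel_measurable (PiM ?A (\<lambda>_. borel))"
    unfolding e_def by (intro borel_measurable_sum borel_measurable_times measurable_component_singleton) auto
  have B_meas: "(\<lambda>\<omega>. restrict (\<lambda>t. \<nu> t \<omega>) ?B) \<in> measurable Q (PiM ?B (\<lambda>_. borel))"
    by (intro measurable_restrict innov_measurable) auto
  have ind: "indep_var borel E borel D"
  proof -
    have "indep_var (PiM ?A (\<lambda>_. borel)) (\<lambda>\<omega>. restrict (\<lambda>t. \<nu> t \<omega>) ?A)
        (PiM ?B (\<lambda>_. borel)) (\<lambda>\<omega>. restrict (\<lambda>t. \<nu> t \<omega>) ?B)"
      by (rule indep_var_restrict[OF innov_indep]) auto
    from indep_var_compose[OF this e_meas borel_measurable_diff[OF F_meas G_meas]]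
    show ?thesis by (simp add: comp_def E_def[abs_def] D_def[abs_def])
  qed
  have E_eq: "E \<omega> = (\<Sum>j<h. \<phi> j * \<nu> (int (T + h) - int j) \<omega>)" for \<omega>
    by (auto simp: E_def e_def intro!: sum.cong)
  have F_eq: "F (restrict (\<lambda>t. \<nu> t \<omega>) ?B) = ma_forecast T h \<omega>" for \<omega>
    unfolding F_def ma_forecast_def by (intro sum.cong) auto
  have G_eq: "G (restrict (\<lambda>t. \<nu> t \<omega>) ?B) = f \<omega>" if "\<omega> \<in> space Q" for \<omega>
  proof -
    \<comment> \<open>The sample up to \<open>T\<close> is determined by the innovations up to \<open>T\<close>.\<close>
    have "(\<Sum>j\<le>t. \<phi> j * restrict (\<lambda>t. \<nu> t \<omega>) ?B (int t - int j)) = x (int t) \<omega>" if "t \<le> T" for t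
      unfolding ma_finite[OF \<open>\<omega> \<in> space Q\<close>] using that by (intro sum.cong) auto
    then show ?thesis
      unfolding G_def g[OF that] by (intro arg_cong[where f = g]) auto
  qed
  have D_eq: "D \<omega> = ma_forecast T h \<omega> - f \<omega>" if "\<omega> \<in> space Q" for \<omega>
    using F_eq G_eq[OF that] by (simp add: D_def)
  have x_eq: "x (int (T + h)) \<omega> = E \<omega> + ma_forecast T h \<omega>" if "\<omega> \<in> space Q" for \<omega>
  proof -
    have "{..T + h} = {..<h} \<union> {h..T + h}" by auto
    then have "x (int (T + h)) \<omega> = E \<omega> + (\<Sum>j=h..T + h. \<phi> j * \<nu> (int (T + h) - int j) \<omega>)"
      unfolding ma_finite[OF that] E_eq by (simp add: sum.union_disjoint ivl_disj_int)
    also have "(\<Sum>j=h..T + h. \<phi> j * \<nu> (int (T + h) - int j) \<omega>) = ma_forecast T h \<omega>"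
      unfolding ma_forecast_def by (intro sum.cong) (auto simp: algebra_simps)
    finally show ?thesis .
  qed
  have E_meas: "E \<in> borel_measurable Q" and D_meas: "D \<in> borel_measurable Q"
    using ind by (auto dest: indep_var_rv1 indep_var_rv2)
  have E_sq: "integrable Q (\<lambda>\<omega>. (E \<omega>)\<^sup>2)"
    unfolding E_eq by (rule linear_combination_second_moment) (auto simp: inj_on_def)
  have ma_sq: "integrable Q (\<lambda>\<omega>. (ma_forecast T h \<omega>)\<^sup>2)"
    using ma_forecast_in_forecasts by (simp add: forecasts_def)
  have ma_meas: "ma_forecast T h \<in> borel_measurable Q"
    using measurable_compose[OF B_meas F_meas] by (simp add: F_eq)
  have f_meas: "f \<in> borel_measurable Q"
    using measurable_compose[OF B_meas G_meas] by (simp add: G_eq cong: measurable_cong)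
  show diff_sq: "integrable Q (\<lambda>\<omega>. (ma_forecast T h \<omega> - f \<omega>)\<^sup>2)"
    by (rule integrable_square_diff[OF ma_meas f_meas ma_sq f_sq])
  then have D_sq: "integrable Q (\<lambda>\<omega>. (D \<omega>)\<^sup>2)"
    by (simp add: D_eq cong: Bochner_Integration.integrable_cong)
  have E_int: "integrable Q E" and D_int: "integrable Q D"
    by (rule square_integrable_imp_integrable[OF E_meas E_sq],
        rule square_integrable_imp_integrable[OF D_meas D_sq])
  have "expectation E = 0"
    unfolding E_eq[abs_def] using integrable_innov innov_mean by simp
  then have cross: "expectation (\<lambda>\<omega>. E \<omega> * D \<omega>) = 0"
    using indep_var_lebesgue_integral[OF ind E_int D_int] by simp
  have "expectation (\<lambda>\<omega>. (x (int (T + h)) \<omega> - f \<omega>)\<^sup>2) =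
      expectation (\<lambda>\<omega>. (E \<omega>)\<^sup>2 + 2 * (E \<omega> * D \<omega>) + (D \<omega>)\<^sup>2)"
    by (intro Bochner_Integration.integral_cong refl, simp only: x_eq D_eq)
      (simp add: power2_eq_square algebra_simps)
  also have "\<dots> = expectation (\<lambda>\<omega>. (E \<omega>)\<^sup>2) + expectation (\<lambda>\<omega>. (D \<omega>)\<^sup>2)"
    using E_sq D_sq cross indep_var_integrable[OF ind E_int D_int] by simp
  also have "expectation (\<lambda>\<omega>. (E \<omega>)\<^sup>2) = expectation (\<lambda>\<omega>. (x (int (T + h)) \<omega> - ma_forecast T h \<omega>)\<^sup>2)"
    by (intro Bochner_Integration.integral_cong refl, simp only: x_eq) simp
  also have "expectation (\<lambda>\<omega>. (D \<omega>)\<^sup>2) = expectation (\<lambda>\<omega>. (ma_forecast T h \<omega> - f \<omega>)\<^sup>2)"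
    by (intro Bochner_Integration.integral_cong) (auto simp: D_eq)
  finally show "expectation (\<lambda>\<omega>. (x (int (T + h)) \<omega> - f \<omega>)\<^sup>2) =
      expectation (\<lambda>\<omega>. (x (int (T + h)) \<omega> - ma_forecast T h \<omega>)\<^sup>2) +
      expectation (\<lambda>\<omega>. (ma_forecast T h \<omega> - f \<omega>)\<^sup>2)" .
qed

lemma ma_forecast_mmse: "mmse_forecast Q x T h (ma_forecast T h)"
  unfolding mmse_forecast_def
proof (intro conjI ballI ma_forecast_in_forecasts)
  fix f assume f: "f \<in> forecasts Q x T"
  have "expectation (\<lambda>\<omega>. (ma_forecast T h \<omega> - f \<omega>)\<^sup>2) \<ge> 0"
    by (rule integral_nonneg_AE) simp
  then show "expectation (\<lambda>\<omega>. (x (int (T + h)) \<omega> - ma_forecast T h \<omega>)\<^sup>2) \<le>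
      expectation (\<lambda>\<omega>. (x (int (T + h)) \<omega> - f \<omega>)\<^sup>2)"
    using forecast_error_pythagoras(2)[OF f, of h] by linarith
qed

lemma mmse_forecast_unique:
  assumes "mmse_forecast Q x T h f"
  shows "AE \<omega> in Q. f \<omega> = ma_forecast T h \<omega>"
proof -
  have f: "f \<in> forecasts Q x T" using assms by (simp add: mmse_forecast_def)
  have "expectation (\<lambda>\<omega>. (x (int (T + h)) \<omega> - f \<omega>)\<^sup>2) \<le>
      expectation (\<lambda>\<omega>. (x (int (T + h)) \<omega> - ma_forecast T h \<omega>)\<^sup>2)"
    using assms ma_forecast_in_forecasts by (auto simp: mmse_forecast_def)
  then have "expectation (\<lambda>\<omega>. (ma_forecast T h \<omega> - f \<omega>)\<^sup>2) \<le> 0"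
    using forecast_error_pythagoras(2)[OF f, of h] by linarith
  then have "expectation (\<lambda>\<omega>. (ma_forecast T h \<omega> - f \<omega>)\<^sup>2) = 0"
    by (simp add: antisym integral_nonneg_AE)
  then have "AE \<omega> in Q. (ma_forecast T h \<omega> - f \<omega>)\<^sup>2 = 0"
    using integral_nonneg_eq_0_iff_AE[OF forecast_error_pythagoras(1)[OF f, of h]] by simp
  then show ?thesis by eventually_elim simp
qed

end

theorem theorem3:
  fixes a b \<sigma> :: real
    and P :: "'p measure" and Q :: "'q measure"
    and \<alpha> :: "nat \<Rightarrow> 'p \<Rightarrow> real" and \<epsilon> X :: "nat \<Rightarrow> int \<Rightarrow> 'p \<Rightarrow> real"
    and \<phi> :: "nat \<Rightarrow> real" and \<nu> x :: "int \<Rightarrow> 'q \<Rightarrow> real"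
    and T h :: nat
  assumes "a > 0" "b > 0" "\<sigma> > 0"
    and "csa_panel P a b \<sigma> \<alpha> \<epsilon> X"
    and "cross_agg_limit P X Q x"
    and "type_II_ma Q \<phi> \<nu> x"
  defines "forecast \<equiv> \<lambda>\<omega>. \<Sum>j=h..T + h. \<phi> j * \<nu> (int T - int j + int h) \<omega>"
  shows "(\<forall>j. \<phi> j = (Beta (a + real j) b / Beta a b) powr (1 / 2)) \<and>
         (\<forall>i\<le>T. \<forall>\<omega>\<in>space Q.
            \<nu> (int i) \<omega> = x (int i) \<omega> - (\<Sum>j=1..i. \<phi> j * \<nu> (int i - int j) \<omega>)) \<and>
         mmse_forecast Q x T h forecast \<and>
         (\<forall>f. mmse_forecast Q x T h f \<longrightarrow> (AE \<omega> in Q. f \<omega> = forecast \<omega>))"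
proof -
  interpret panel: csa_panel P a b \<sigma> \<alpha> \<epsilon> X by fact
  interpret limit: type_II_ma Q \<phi> \<nu> x by fact
  have Bpos: "Beta (a + real k) b > 0" for k
    using \<open>a > 0\<close> \<open>b > 0\<close> by (intro Beta_pos) auto
  have coeff: "\<phi> j = (Beta (a + real j) b / Beta a b) powr (1 / 2)" for j
  proof -
    have "\<phi> j = sqrt (Beta (a + real j) b / Beta a b)"
    proof (rule limit.coeff_eq_sqrt)
      show "limit.expectation (\<lambda>\<omega>. (x (int t) \<omega>)\<^sup>2) =
          \<sigma>\<^sup>2 * (\<Sum>k\<le>t. Beta (a + real k) b / Beta a b)" for t
        using assms limit.prob_space_axioms by (intro panel.limit_second_moment)
    qed (use \<open>\<sigma> > 0\<close> Bpos[of 0] in auto)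
    then show ?thesis using Bpos[of j] Bpos[of 0] by (simp add: powr_half_sqrt)
  qed
  have "forecast = limit.ma_forecast T h"
    by (simp add: fun_eq_iff forecast_def limit.ma_forecast_def)
  then show ?thesis
    using coeff limit.innov_recursion limit.ma_forecast_mmse limit.mmse_forecast_unique by simp
qed

end
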